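(* Let $P$ be a probability distribution supported on a finite set $\{a_1,\dots,a_k\}$ of cardinality $k\ge2$, with $p_j=P(\{a_j\})$; let $(X_t)_{t\ge1}$ be i.i.d. from $P$ with empirical measure $P_t=\frac1t\sum_{i=1}^t\delta_{X_i}$. Let $\ell:[0,\infty)\to[1,\infty)$ satisfy $\sum_{j=1}^\infty1/\ell(j)\le1$, $\ell(x)=\ell(1)$ for all $x\in[0,1]$, and $u\mapsto2^{-u}\log\ell(u)$ decreasing (not necessarily strictly) on $[1,\infty)$. Then for all $\delta\in(0,1)$, $$\mathbb{P}\left\{\exists t\ge1:\|P_t-P\|_{\mathrm{TV}}\ge\sqrt{\frac{k}{\pi t}}+2\left(\frac{2k}{t}\right)^{3/4}+2\sqrt{\frac2t\Big[\log\ell(\log_2t)+\log(1/\delta)\Big]}\right\}\le\delta.$$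
   Context: $\|P_t-P\|_{\mathrm{TV}}=\frac12\sum_{j=1}^k\big|P_t(\{a_j\})-p_j\big|$ is the total variation distance; $t$ ranges over positive integers. *)

theory Defs
  imports "HOL-Probability.Probability"
begin

text \<open>
  The empirical measure \<open>(1/t) \<Sum>i\<le>t. \<delta>(X i \<omega>)\<close> of the first \<open>t\<close> samples (indexed from 1), as a
  measure on the measurable space \<open>S\<close>. The Dirac measure at \<open>x\<close> is \<^term>\<open>return S x\<close>.
\<close>

definition empirical_measure ::
  "'a measure \<Rightarrow> (nat \<Rightarrow> 'w \<Rightarrow> 'a) \<Rightarrow> nat \<Rightarrow> 'w \<Rightarrow> 'a measure" where
  "empirical_measure S X t \<omega> =
     measure_of (space S) (sets S)
       (\<lambda>B. (\<Sum>i=1..t. emeasure (return S (X i \<omega>)) B) / of_nat t)"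

definition tv_dist :: "'a set \<Rightarrow> 'a measure \<Rightarrow> 'a measure \<Rightarrow> real" where
  "tv_dist A Q P = 1 / 2 * (\<Sum>a\<in>A. \<bar>measure Q {a} - measure P {a}\<bar>)"

lemma space_empirical_measure [simp]: "space (empirical_measure S X t \<omega>) = space S"
  by (simp add: empirical_measure_def)

lemma sets_empirical_measure [simp, measurable_cong]:
  "sets (empirical_measure S X t \<omega>) = sets S"
  by (simp add: empirical_measure_def)

lemma emeasure_empirical_measure:
  assumes B: "B \<in> sets S"
  shows "emeasure (empirical_measure S X t \<omega>) B =
           (\<Sum>i=1..t. emeasure (return S (X i \<omega>)) B) / of_nat t"
proof (rule emeasure_measure_of[OF empirical_measure_def])
  show "sets S \<subseteq> Pow (space S)"
    by (rule sets.space_closed)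
  show "B \<in> sets (empirical_measure S X t \<omega>)"
    using B by simp
  let ?e = "\<lambda>B. (\<Sum>i=1..t. emeasure (return S (X i \<omega>)) B) / of_nat t"
  show "positive (sets (empirical_measure S X t \<omega>)) ?e"
    by (simp add: positive_def)
  show "countably_additive (sets (empirical_measure S X t \<omega>)) ?e"
  proof (rule countably_additiveI)
    fix F :: "nat \<Rightarrow> 'a set"
    assume F: "range F \<subseteq> sets (empirical_measure S X t \<omega>)" "disjoint_family F"
    have "(\<Sum>n. ?e (F n)) = (\<Sum>n. \<Sum>i=1..t. emeasure (return S (X i \<omega>)) (F n)) / of_nat t"
      by (simp add: divide_ennreal_def)
    also have "(\<Sum>n. \<Sum>i=1..t. emeasure (return S (X i \<omega>)) (F n)) =
        (\<Sum>i=1..t. \<Sum>n. emeasure (return S (X i \<omega>)) (F n))"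
      by (rule suminf_sum) simp
    also have "\<dots> = (\<Sum>i=1..t. emeasure (return S (X i \<omega>)) (\<Union>n. F n))"
      using F by (intro sum.cong refl suminf_emeasure) auto
    finally show "(\<Sum>n. ?e (F n)) = ?e (\<Union>n. F n)" .
  qed
qed

lemma measure_empirical_measure:
  assumes B: "B \<in> sets S"
  shows "measure (empirical_measure S X t \<omega>) B = (\<Sum>i=1..t. indicator B (X i \<omega>)) / real t"
proof (cases "t = 0")
  case True
  then show ?thesis
    by (simp add: measure_def emeasure_empirical_measure[OF B])
next
  case False
  have "(\<Sum>i=1..t. emeasure (return S (X i \<omega>)) B) =
      ennreal (\<Sum>i=1..t. indicator B (X i \<omega>) :: real)"
    using B by (simp add: ennreal_indicator flip: sum_ennreal)
  with False show ?thesis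
    by (simp add: measure_def emeasure_empirical_measure[OF B] divide_ennreal
        sum_nonneg flip: ennreal_of_nat_eq_real_of_nat)
       (simp add: ennreal_of_nat_eq_real_of_nat divide_ennreal sum_nonneg)
qed

end

theory Submission
  imports Defs "HOL-Real_Asymp.Real_Asymp"
begin

text \<open>
  The vector of centred counts \<open>S_t = t (P_t - P)\<close> is a martingale, so \<open>exp (c \<parallel>S_t\<parallel>)\<close> is a
  submartingale and Doob's inequality on the dyadic epoch \<open>2^j \<le> t \<le> N = 2^(j+1)\<close> reduces the claim to
  an exponential moment of \<open>\<parallel>S_N\<parallel>\<close>. One sample moves \<open>\<parallel>S_N\<parallel>\<close> by at most 1, so McDiarmid's argument
  bounds the epoch's failure probability by \<open>\<delta> / l (j + 1)\<close>; a union bound over \<open>j\<close> finishes the proof.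
  The constant \<open>\<pi>\<close> comes from the mean of \<open>\<parallel>S_N\<parallel>\<close>, a sum of mean absolute deviations of binomial
  variables: by de Moivre's formula each is a single binomial weight, which Stirling's formula
  estimates up to an additive constant. That constant is absorbed by the \<open>(2k/t)^(3/4)\<close> term.
\<close>

subsection \<open>Stirling lower bound and binomial weights\<close>

text \<open>Midpoint and trapezoid rules for the integral of the convex function
  \<open>1 / x\<close> over \<open>[n, n + 1]\<close>. The trapezoid error is written as a
  difference so that it telescopes.\<close>

lemma ln_Suc_div_bounds:
  assumes "n \<ge> 1"
  shows "1 \<le> (real n + 1/2) * ln ((real n + 1) / real n)"
    and "(real n + 1/2) * ln ((real n + 1) / real n) \<le> 1 + (1 / (4 * real n) - 1 / (4 * (real n + 1)))"
proof -
  have n: "real n > 0" using assms by simp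
  have "2 / (2 * real n + 1) \<le> ln ((real n + 1) / real n)"
    using ln_inverse_approx_ge[of "real n" "real n + 1"] n by (simp add: ln_div)
  then show "1 \<le> (real n + 1/2) * ln ((real n + 1) / real n)"
    using n by (simp add: field_simps)
  have "ln ((real n + 1) / real n) \<le> (inverse (real n) + inverse (real n + 1)) / 2"
    using ln_inverse_approx_le[of "real n" 1] n by (simp add: ln_div)
  then have "(real n + 1/2) * ln ((real n + 1) / real n)
      \<le> (real n + 1/2) * ((inverse (real n) + inverse (real n + 1)) / 2)"
    by (intro mult_left_mono) auto
  also have "\<dots> = 1 + (1 / (4 * real n) - 1 / (4 * (real n + 1)))"
    using n by (simp add: divide_simps) (simp add: algebra_simps)
  finally show "(real n + 1/2) * ln ((real n + 1) / real n)
      \<le> 1 + (1 / (4 * real n) - 1 / (4 * (real n + 1)))" .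
qed

text \<open>Stirling's quotient without the factor \<open>sqrt (2 * pi)\<close>, which is identified
  below as its limit. Division by zero gives the value 0 at \<open>n = 0\<close>, hence the shifts
  by \<open>Suc\<close> below.\<close>

definition stirling_ratio :: "nat \<Rightarrow> real" where
  "stirling_ratio n = fact n * exp (real n) / (real n ^ n * sqrt (real n))"

lemma stirling_ratio_pos: "n \<ge> 1 \<Longrightarrow> stirling_ratio n > 0"
  by (simp add: stirling_ratio_def)

lemma ln_stirling_ratio_Suc:
  assumes "n \<ge> 1"
  shows "ln (stirling_ratio n) - ln (stirling_ratio (Suc n)) =
     (real n + 1/2) * ln ((real n + 1) / real n) - 1"
proof -
  have *: "ln (stirling_ratio m) = ln (fact m) + real m - (real m + 1/2) * ln (real m)" if "m \<ge> 1" for m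
    using that by (simp add: stirling_ratio_def ln_mult ln_div ln_realpow ln_sqrt algebra_simps)
  have f: "ln (fact (Suc n) :: real) = ln (real n + 1) + ln (fact n)"
    unfolding fact_Suc by (subst ln_mult) (auto simp: add.commute)
  have g: "real (Suc n) = real n + 1" by simp
  show ?thesis using assms
    by (subst (1 2) *) (auto simp: f g ln_div algebra_simps simp del: fact_Suc of_nat_Suc)
qed

lemma stirling_ratio_decseq: "decseq (\<lambda>n. stirling_ratio (Suc n))"
proof (rule decseq_SucI)
  fix n
  have "ln (stirling_ratio (Suc (Suc n))) \<le> ln (stirling_ratio (Suc n))"
    using ln_stirling_ratio_Suc[of "Suc n"] ln_Suc_div_bounds(1)[of "Suc n"] by simp
  then show "stirling_ratio (Suc (Suc n)) \<le> stirling_ratio (Suc n)"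
    by (simp add: stirling_ratio_pos)
qed

text \<open>Keeps the limit away from 0. By the trapezoid bound,
  \<open>ln (stirling_ratio n) - 1 / (4 * n)\<close> is nondecreasing, and at \<open>n = 1\<close>
  it equals \<open>1 - 1 / 4\<close>.\<close>

lemma stirling_ratio_lower: "stirling_ratio (Suc n) \<ge> exp (3/4)"
proof -
  have "ln (stirling_ratio (Suc n)) - 1 / (4 * real (Suc n)) \<ge> 3/4"
  proof (induction n)
    case 0
    then show ?case by (simp add: stirling_ratio_def)
  next
    case (Suc n)
    then show ?case
      using ln_stirling_ratio_Suc[of "Suc n"] ln_Suc_div_bounds(2)[of "Suc n"] by (simp add: add.commute)
  qed
  moreover have "1 / (4 * real (Suc n)) \<ge> 0" by simp
  ultimately have "ln (stirling_ratio (Suc n)) \<ge> 3/4" by linarith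
  then show ?thesis by (subst (asm) ln_ge_iff) (auto simp: stirling_ratio_pos)
qed

text \<open>Expresses Wallis' partial products through \<open>4 ^ n\<close> over the central
  binomial coefficient, the link between factorials and \<pi>.\<close>

lemma wallis_prod:
  "(\<Prod>k=1..n. (4*real k^2) / (4*real k^2 - 1)) = (4 ^ n * fact n ^ 2 / fact (2 * n)) ^ 2 / (2 * real n + 1)"
proof (induction n)
  case 0
  then show ?case by simp
next
  case (Suc n)
  have "(\<Prod>k=1..Suc n. (4*real k^2) / (4*real k^2 - 1)) =
     (4 ^ n * fact n ^ 2 / fact (2 * n)) ^ 2 / (2 * real n + 1) * ((4*real (Suc n)^2) / (4*real (Suc n)^2 - 1))"
    using Suc by simp
  also have "4*real (Suc n)^2 - 1 = (2 * real n + 1) * (2 * real n + 3)"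
    by (simp add: algebra_simps power2_eq_square)
  also have "(4 ^ n * fact n ^ 2 / fact (2 * n)) ^ 2 / (2 * real n + 1) * ((4*real (Suc n)^2) / ((2 * real n + 1) * (2 * real n + 3)))
     = (4 ^ n * fact n ^ 2 / fact (2 * n) * (2 * real (Suc n) / (2 * real n + 1))) ^ 2 / (2 * real n + 3)"
  proof -
    have "F ^ 2 / x * (4 * s ^ 2 / (x * y)) = (F * (2 * s / x)) ^ 2 / y" for F x y s :: real
      by (simp add: power2_eq_square mult_ac)
    then show ?thesis .
  qed
  also have "4 ^ n * fact n ^ 2 / fact (2 * n) * (2 * real (Suc n) / (2 * real n + 1)) = 4 ^ Suc n * fact (Suc n) ^ 2 / (fact (2 * Suc n) :: real)"
  proof -
    have f: "(fact (2 * Suc n) :: real) = (2 * real (Suc n)) * (2 * real n + 1) * fact (2 * n)"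
      by (simp add: algebra_simps)
    have g: "(fact (Suc n) :: real) ^ 2 = real (Suc n) ^ 2 * fact n ^ 2"
      by (simp add: power_mult_distrib)
    show ?thesis unfolding f g
      by (simp add: divide_simps power2_eq_square del: of_nat_Suc)
  qed
  finally show ?case by (simp add: add.commute)
qed

text \<open>In this quotient the exponentials and the powers \<open>n ^ n\<close> cancel. What
  remains is \<open>4 ^ n\<close> over the central binomial coefficient, times
  \<open>sqrt (2 / n)\<close>, and Wallis' product governs it.\<close>

lemma stirling_ratio_double:
  assumes "n \<ge> 1"
  shows "(stirling_ratio n ^ 2 / stirling_ratio (2 * n)) ^ 2 =
     (2 * (2 * real n + 1) / real n) * (\<Prod>k=1..n. (4*real k^2) / (4*real k^2 - 1))"
proof -
  have "stirling_ratio n ^ 2 / stirling_ratio (2 * n) =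
     (4 ^ n * fact n ^ 2 / fact (2 * n)) * (sqrt 2 / sqrt (real n))"
  proof -
    have e: "exp (real (2 * n)) = exp (real n) ^ 2"
      by (simp add: exp_double)
    have p: "real (2 * n) ^ (2 * n) = 4 ^ n * (real n ^ n) ^ 2"
    proof -
      have "real (2 * n) ^ (2 * n) = ((2 * real n) ^ 2) ^ n"
        by (simp add: power_mult)
      also have "\<dots> = 4 ^ n * (real n ^ 2) ^ n"
        by (simp add: power_mult_distrib)
      also have "(real n ^ 2) ^ n = (real n ^ n) ^ 2"
        by (simp add: mult.commute flip: power_mult)
      finally show ?thesis .
    qed
    have s: "sqrt (real (2 * n)) = sqrt 2 * sqrt (real n)" by (simp add: real_sqrt_mult)
    have *: "(f * e / (x * r)) ^ 2 / (F * e ^ 2 / ((a * x ^ 2) * (t * r))) = (a * f ^ 2 / F) * (t / r)"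
      if "e \<noteq> 0" "x \<noteq> 0" "r \<noteq> 0" for f e x r F a t :: real
      using that by (cases "F = 0 \<or> a = 0 \<or> t = 0") (auto simp: power2_eq_square divide_simps)
    show ?thesis unfolding stirling_ratio_def e p s
      by (rule *) (use assms in auto)
  qed
  moreover have "(a * (sqrt 2 / sqrt (real n))) ^ 2
      = (2 * (2 * real n + 1) / real n) * (a ^ 2 / (2 * real n + 1))" for a
  proof -
    have "2 * c / x * (b / c) = b * (2 / x)" if "c \<noteq> 0" for b c x :: real
      using that by simp
    from this[of "2 * real n + 1"] show ?thesis
      by (simp add: power_mult_distrib power_divide del: times_divide_eq_right times_divide_eq_left)
  qed
  ultimately show ?thesis
    unfolding wallis_prod by (simp only:)
qed

text \<open>The ratio decreases to a limit \<open>c > 0\<close> and so stays above it. The quotient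
  in \<open>stirling_ratio_double\<close> tends to \<open>c ^ 2 / c = c\<close>, and Wallis' product
  forces \<open>c ^ 2 = 2 * pi\<close>.\<close>

lemma stirling_ratio_ge:
  assumes "n \<ge> 1"
  shows "stirling_ratio n \<ge> sqrt (2 * pi)"
proof -
  have "bdd_below (range (\<lambda>n. stirling_ratio (Suc n)))"
    using stirling_ratio_lower by (auto intro!: bdd_belowI)
  then obtain c where c: "(\<lambda>n. stirling_ratio (Suc n)) \<longlonglongrightarrow> c"
    and cle: "\<And>n. c \<le> stirling_ratio (Suc n)"
    using decseq_convergent[OF stirling_ratio_decseq, of "exp (3/4)"] stirling_ratio_lower by metis
  have "c \<ge> exp (3/4)"
    using c stirling_ratio_lower by (meson LIMSEQ_le_const)
  then have c0: "c > 0" by (meson exp_gt_zero less_le_trans)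
  have c': "stirling_ratio \<longlonglongrightarrow> c" using c by (simp add: filterlim_sequentially_Suc)
  have "(\<lambda>n. stirling_ratio (2 * n)) \<longlonglongrightarrow> c"
    using LIMSEQ_subseq_LIMSEQ[OF c', of "\<lambda>n. 2 * n"] by (simp add: strict_mono_def o_def)
  then have "(\<lambda>n. (stirling_ratio n ^ 2 / stirling_ratio (2 * n)) ^ 2) \<longlonglongrightarrow> (c ^ 2 / c) ^ 2"
    using c' c0 by (intro tendsto_intros) auto
  moreover have "(\<lambda>n. (2 * (2 * real n + 1) / real n) * (\<Prod>k=1..n. (4*real k^2) / (4*real k^2 - 1)))
     \<longlonglongrightarrow> 4 * (pi / 2)"
    by (intro tendsto_mult wallis) real_asymp
  then have "(\<lambda>n. (stirling_ratio n ^ 2 / stirling_ratio (2 * n)) ^ 2) \<longlonglongrightarrow> 4 * (pi / 2)"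
    by (rule Lim_transform_eventually) (use eventually_ge_at_top[of 1] in eventually_elim, simp add: stirling_ratio_double)
  ultimately have "(c ^ 2 / c) ^ 2 = 4 * (pi / 2)" by (rule LIMSEQ_unique)
  then have "c ^ 2 = 2 * pi" using c0 by (simp add: power2_eq_square)
  then have "c = sqrt (2 * pi)" using c0 by (metis less_le real_sqrt_unique)
  then show ?thesis using cle[of "n - 1"] assms by simp
qed

text \<open>For fixed \<open>m\<close> the weight is largest at \<open>p = m / n\<close>, where it
  is an exact expression in Stirling quotients. Monotonicity handles
  \<open>stirling_ratio n / stirling_ratio m\<close>, and the lower bound
  \<open>sqrt (2 * pi)\<close> handles \<open>stirling_ratio (n - m)\<close>.\<close>

lemma binomial_weight_le:
  fixes p :: real
  assumes p: "0 < p" "p < 1" and m: "1 \<le> m" "m < n"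
  shows "real (n choose m) * p ^ m * (1 - p) ^ (n - m)
     \<le> sqrt (real n / (2 * pi * real m * real (n - m)))"
proof -
  let ?m = "real m" and ?n = "real n" and ?d = "real (n - m)"
  have d: "?d = ?n - ?m" "?d > 0" using m by auto
  have pow: "p ^ m * (1 - p) ^ (n - m) \<le> (?m / ?n) ^ m * (?d / ?n) ^ (n - m)"
  proof -
    define r r' where "r = ?m / ?n" and "r' = ?d / ?n"
    have r: "r > 0" "r' > 0" using m d by (auto simp: r_def r'_def)
    \<comment> \<open>Gibbs' inequality: \<open>ln x \<le> x - 1\<close> is applied to both factors,
      and the linear bounds, weighted by \<open>m\<close> and \<open>n - m\<close>, cancel.\<close>
    have "ln (p / r) \<le> p / r - 1" "ln ((1 - p) / r') \<le> (1 - p) / r' - 1"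
      using p r by (auto intro!: ln_le_minus_one)
    then have "?m * ln (p / r) + ?d * ln ((1 - p) / r')
        \<le> ?m * (p / r - 1) + ?d * ((1 - p) / r' - 1)"
      using d by (intro add_mono mult_left_mono) auto
    also have "\<dots> = 0" using m d by (simp add: r_def r'_def field_simps)
    finally have "ln (p ^ m * (1 - p) ^ (n - m)) \<le> ln (r ^ m * r' ^ (n - m))"
      using p r by (simp add: ln_mult ln_realpow ln_div right_diff_distrib)
    then show ?thesis using p r by (simp flip: r_def r'_def)
  qed
  have s: "stirling_ratio n \<le> stirling_ratio m"
    using decseqD[OF stirling_ratio_decseq, of "m - 1" "n - 1"] m by simp
  have choose: "real (n choose m) = fact n / (fact m * fact (n - m))"
    using m by (simp add: binomial_fact)
  have eq: "real (n choose m) * ((?m / ?n) ^ m * (?d / ?n) ^ (n - m)) =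
     stirling_ratio n / (stirling_ratio m * stirling_ratio (n - m)) * sqrt (?n / (?m * ?d))"
  proof -
    have e: "exp ?n = exp ?m * exp ?d" using d by (simp flip: exp_add)
    have pn: "?n ^ n = ?n ^ m * ?n ^ (n - m)" using m by (simp flip: power_add)
    show ?thesis unfolding stirling_ratio_def choose e pn real_sqrt_divide real_sqrt_mult power_divide
      using m d(2) by (simp add: divide_simps)
  qed
  have "stirling_ratio n / (stirling_ratio m * stirling_ratio (n - m)) \<le> 1 / sqrt (2 * pi)"
  proof -
    have "stirling_ratio n * sqrt (2 * pi) \<le> stirling_ratio m * stirling_ratio (n - m)"
      using s stirling_ratio_ge[of "n - m"] stirling_ratio_pos[of m] m
      by (intro mult_mono) auto
    then show ?thesis using stirling_ratio_pos[of m] stirling_ratio_pos[of "n - m"] m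
      by (simp add: divide_simps)
  qed
  then have "real (n choose m) * ((?m / ?n) ^ m * (?d / ?n) ^ (n - m)) \<le> 1 / sqrt (2 * pi) * sqrt (?n / (?m * ?d))"
    unfolding eq by (intro mult_right_mono) auto
  also have "\<dots> = sqrt (?n / (2 * pi * ?m * ?d))"
    by (simp add: real_sqrt_divide real_sqrt_mult)
  finally show ?thesis
    using mult_left_mono[OF pow, of "real (n choose m)"] by (simp add: mult.assoc)
qed

subsection \<open>Mean absolute deviation of the binomial distribution\<close>

definition binom_weight :: "nat \<Rightarrow> real \<Rightarrow> nat \<Rightarrow> real" where
  "binom_weight n p i = real (n choose i) * p ^ i * (1 - p) ^ (n - i)"

definition binom_mad :: "nat \<Rightarrow> real \<Rightarrow> real" where
  "binom_mad n p = (\<Sum>i\<le>n. binom_weight n p i * \<bar>real i - real n * p\<bar>)"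

lemma binom_weight_nonneg: "0 \<le> p \<Longrightarrow> p \<le> 1 \<Longrightarrow> 0 \<le> binom_weight n p i"
  by (simp add: binom_weight_def)

lemma sum_binom_weight: "(\<Sum>i\<le>n. binom_weight n p i) = 1"
  using binomial_ring[of p "1 - p" n] by (simp add: binom_weight_def)

text \<open>Conditioning on one trial, by Pascal's rule. It matches a single step of the walk in
  \<open>walk_exp_half_l1_eq\<close>.\<close>

lemma sum_binom_weight_Suc:
  "(\<Sum>i\<le>Suc n. binom_weight (Suc n) p i * h i) =
    p * (\<Sum>i\<le>n. binom_weight n p i * h (Suc i)) + (1 - p) * (\<Sum>i\<le>n. binom_weight n p i * h i)"
proof -
  have pascal: "binom_weight (Suc n) p (Suc i) = p * binom_weight n p i + (1 - p) * binom_weight n p (Suc i)"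
    if "i \<le> n" for i
  proof (cases "i = n")
    case False
    then have "n - i = Suc (n - Suc i)" using that by simp
    then show ?thesis by (simp add: binom_weight_def algebra_simps)
  qed (simp add: binom_weight_def)
  have "(\<Sum>i\<le>Suc n. binom_weight (Suc n) p i * h i) =
     (1 - p) * binom_weight n p 0 * h 0 + (\<Sum>i\<le>n. binom_weight (Suc n) p (Suc i) * h (Suc i))"
    by (subst sum.atMost_Suc_shift) (simp add: binom_weight_def)
  also have "(\<Sum>i\<le>n. binom_weight (Suc n) p (Suc i) * h (Suc i)) =
     p * (\<Sum>i\<le>n. binom_weight n p i * h (Suc i)) + (1 - p) * (\<Sum>i\<le>n. binom_weight n p (Suc i) * h (Suc i))"
    by (simp add: pascal distrib_right sum.distrib sum_distrib_left mult.assoc)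
  also have "(1 - p) * binom_weight n p 0 * h 0 + (p * (\<Sum>i\<le>n. binom_weight n p i * h (Suc i))
      + (1 - p) * (\<Sum>i\<le>n. binom_weight n p (Suc i) * h (Suc i)))
    = p * (\<Sum>i\<le>n. binom_weight n p i * h (Suc i)) + (1 - p) * (\<Sum>i\<le>Suc n. binom_weight n p i * h i)"
    by (simp add: sum.atMost_Suc_shift algebra_simps del: sum.atMost_Suc)
  \<comment> \<open>The extra term \<open>i = n + 1\<close> vanishes with its binomial
    coefficient.\<close>
  also have "(\<Sum>i\<le>Suc n. binom_weight n p i * h i) = (\<Sum>i\<le>n. binom_weight n p i * h i)"
    by (simp add: binom_weight_def)
  finally show ?thesis .
qed

text \<open>The ratio of neighbouring weights, cross-multiplied so that it also covers
  \<open>p = 1\<close> and \<open>i \<ge> n\<close>, where both sides vanish.\<close>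

lemma binom_weight_Suc:
  "real (Suc i) * (1 - p) * binom_weight n p (Suc i) = real (n - i) * p * binom_weight n p i"
proof (cases "i < n")
  case True
  have "real (Suc i) * real (n choose Suc i) = real (n - i) * real (n choose i)"
    using binomial_absorb_comp[of n i] binomial_absorption[of i n] choose_mult_lemma
    by (metis True Suc_diff_Suc binomial_absorption binomial_absorb_comp of_nat_mult diff_Suc_1 bot_nat_0.not_eq_extremum)
  moreover have "(1 - p) ^ (n - i) = (1 - p) * (1 - p) ^ (n - Suc i)"
    using True by (metis Suc_diff_Suc power_Suc)
  ultimately have "real (Suc i) * real (n choose Suc i) * ((1 - p) * (1 - p) ^ (n - Suc i))
      = real (n - i) * real (n choose i) * (1 - p) ^ (n - i)" by simp
  then show ?thesis
    by (simp only: binom_weight_def power_Suc mult_ac)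
next
  case False
  then show ?thesis by (simp add: binom_weight_def)
qed

text \<open>Since \<open>i - n * p = i * (1 - p) - (n - i) * p\<close>, the ratio of neighbouring
  weights turns the weighted deviation into a difference of consecutive terms.\<close>

lemma binom_weight_telescope:
  assumes "i \<le> n"
  shows "binom_weight n p i * (real i - real n * p) =
    real i * (1 - p) * binom_weight n p i - real (Suc i) * (1 - p) * binom_weight n p (Suc i)"
  unfolding binom_weight_Suc using assms by (simp add: of_nat_diff algebra_simps)

lemma sum_binom_weight_tail:
  assumes "m \<le> Suc n"
  shows "(\<Sum>i=m..n. binom_weight n p i * (real i - real n * p)) = real m * (1 - p) * binom_weight n p m"
proof -
  have "(\<Sum>i=m..n. binom_weight n p i * (real i - real n * p)) =
    (\<Sum>i=m..n. - (real (Suc i) * (1 - p) * binom_weight n p (Suc i) - real i * (1 - p) * binom_weight n p i))"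
    by (intro sum.cong refl) (subst binom_weight_telescope, auto)
  also have "\<dots> = - (real (Suc n) * (1 - p) * binom_weight n p (Suc n) - real m * (1 - p) * binom_weight n p m)"
    using sum_Suc_diff[OF assms, of "\<lambda>i. real i * (1 - p) * binom_weight n p i"]
    by (simp only: sum_negf)
  finally show ?thesis by (simp add: binom_weight_def)
qed

text \<open>De Moivre's formula for the mean absolute deviation.\<close>

lemma binom_mad_eq:
  assumes m: "m \<le> Suc n" "real m \<ge> real n * p" "real m \<le> real n * p + 1"
  shows "binom_mad n p = 2 * real m * (1 - p) * binom_weight n p m"
proof -
  let ?f = "\<lambda>i. binom_weight n p i * (real i - real n * p)"
  have split: "(\<Sum>i\<le>n. g i) = (\<Sum>i<m. g i) + (\<Sum>i=m..n. g i)" for g :: "nat \<Rightarrow> real"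
  proof -
    have "{..n} = {..<m} \<union> {m..n}" using m(1) by auto
    then show ?thesis by (simp only:) (subst sum.union_disjoint, auto)
  qed
  \<comment> \<open>The tail formula at \<open>m = 0\<close> says that deviations have mean zero, so
    the part below \<open>m\<close> is the negative of the part above.\<close>
  have "(\<Sum>i\<le>n. ?f i) = 0"
    using sum_binom_weight_tail[of 0 n p] by (simp add: atMost_atLeast0)
  then have low: "(\<Sum>i<m. ?f i) = - (\<Sum>i=m..n. ?f i)"
    unfolding split by simp
  have "binom_mad n p = (\<Sum>i<m. - ?f i) + (\<Sum>i=m..n. ?f i)"
    unfolding binom_mad_def split
  proof (intro arg_cong2[where f = "(+)"] sum.cong refl)
    fix i assume "i \<in> {..<m}"
    \<comment> \<open>Together with \<open>m \<le> n * p + 1\<close> this puts \<open>i\<close> at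
      or below the mean, which fixes the sign.\<close>
    then have "real i + 1 \<le> real m" by auto
    then show "binom_weight n p i * \<bar>real i - real n * p\<bar> = - ?f i"
      using m by (simp add: abs_if algebra_simps)
  next
    fix i assume "i \<in> {m..n}"
    then show "binom_weight n p i * \<bar>real i - real n * p\<bar> = ?f i"
      using m by (simp add: abs_if)
  qed
  then show ?thesis
    using low sum_binom_weight_tail[OF m(1)] by (simp add: sum_negf)
qed

text \<open>Each success deviates from \<open>p\<close> by \<open>1 - p\<close> and each failure by
  \<open>p\<close>, so the triangle inequality bounds the deviation by
  \<open>i * (1 - p) + (n - i) * p\<close>. Written as an affine function of
  \<open>i - n * p\<close>, its mean is immediate. This serves small variances and small
  samples.\<close>

lemma binom_mad_le_linear:
  assumes p: "0 \<le> p" "p \<le> 1"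
  shows "binom_mad n p \<le> 2 * real n * p * (1 - p)"
proof -
  have "binom_mad n p \<le> (\<Sum>i\<le>n. binom_weight n p i * ((real i - real n * p) * (1 - 2 * p) + 2 * real n * p * (1 - p)))"
    unfolding binom_mad_def
  proof (intro sum_mono mult_left_mono binom_weight_nonneg p)
    fix i assume i: "i \<in> {..n}"
    have "0 \<le> real i * (1 - p)" "0 \<le> (real n - real i) * p"
      using i p by auto
    moreover have "real i - real n * p = real i * (1 - p) - (real n - real i) * p"
      "(real i - real n * p) * (1 - 2 * p) + 2 * real n * p * (1 - p) = real i * (1 - p) + (real n - real i) * p"
      by (simp_all add: algebra_simps)
    ultimately show "\<bar>real i - real n * p\<bar> \<le> (real i - real n * p) * (1 - 2 * p) + 2 * real n * p * (1 - p)"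
      by linarith
  qed
  also have "\<dots> = (\<Sum>i\<le>n. binom_weight n p i * (real i - real n * p)) * (1 - 2 * p)
      + (\<Sum>i\<le>n. binom_weight n p i) * (2 * real n * p * (1 - p))"
    by (simp only: sum_distrib_right sum.distrib distrib_left mult.assoc)
  also have "(\<Sum>i\<le>n. binom_weight n p i * (real i - real n * p)) = 0"
    using sum_binom_weight_tail[of 0 n p] by (simp add: atMost_atLeast0)
  finally show ?thesis by (simp add: sum_binom_weight)
qed

text \<open>If few successes or few failures are expected, the variance is at most 2 and the linear
  bound gives 4. Otherwise de Moivre's formula and the weight bound apply, and rounding the mean to
  an integer costs a constant under the root.\<close>

lemma binom_mad_le:
  assumes p: "0 \<le> p" "p \<le> 1"
  shows "binom_mad n p \<le> sqrt (2 * real n * p * (1 - p) / pi) + 4"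
proof (cases "real n * p < 1 \<or> real n * (1 - p) < 2")
  case True
  have "real n * p * (1 - p) \<le> 2"
  proof (cases "real n * p < 1")
    case True
    have "real n * p * (1 - p) \<le> 1 * 1"
      using True p by (intro mult_mono) auto
    then show ?thesis by simp
  next
    case False
    then have "real n * (1 - p) * p \<le> 2 * 1"
      using \<open>real n * p < 1 \<or> real n * (1 - p) < 2\<close> p by (intro mult_mono) auto
    then show ?thesis by (simp add: mult_ac)
  qed
  then have "binom_mad n p \<le> 4" using binom_mad_le_linear[OF p, of n] by simp
  moreover have "0 \<le> sqrt (2 * real n * p * (1 - p) / pi)" using p by simp
  ultimately show ?thesis by linarith
next
  case False
  define a b where "a = real n * p" and "b = real n * (1 - p)"
  have ab: "a \<ge> 1" "b \<ge> 2" "a + b = real n" using False by (auto simp: a_def b_def algebra_simps)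
  have n0: "real n > 0" using ab by linarith
  have p': "0 < p" "p < 1"
    using ab by (cases "p = 0"; cases "p = 1"; use p in \<open>simp add: a_def b_def\<close>)+
  \<comment> \<open>The integer just above the mean, as de Moivre's formula requires;
    \<open>b \<ge> 2\<close> ensures \<open>m < n\<close>.\<close>
  define m where "m = nat \<lfloor>a\<rfloor> + 1"
  have m: "a \<le> real m" "real m \<le> a + 1" "1 \<le> m"
    using ab by (auto simp: m_def; linarith)+
  have "real m < real n" using m ab by linarith
  then have mn: "m < n" by simp
  have d: "real (n - m) \<ge> b - 1" "real (n - m) > 0" "real (n - m) = real n - real m"
    using m ab mn by auto
  have "binom_mad n p = 2 * real m * (1 - p) * binom_weight n p m"
    using m mn by (intro binom_mad_eq) (auto simp: a_def)
  also have "\<dots> \<le> 2 * real m * (1 - p) * sqrt (real n / (2 * pi * real m * real (n - m)))"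
    unfolding binom_weight_def using p' m(3) mn
    by (intro mult_left_mono binomial_weight_le) auto
  also have "\<dots> = sqrt ((2 / pi) * ((1 - p) ^ 2 * real n * real m / real (n - m)))"
  proof -
    have "2 * real m * (1 - p) = sqrt ((2 * real m * (1 - p)) ^ 2)" using p' by simp
    then have "2 * real m * (1 - p) * sqrt (real n / (2 * pi * real m * real (n - m)))
      = sqrt ((2 * real m * (1 - p)) ^ 2 * (real n / (2 * pi * real m * real (n - m))))"
      by (metis real_sqrt_mult)
    also have "(2 * real m * (1 - p)) ^ 2 * (real n / (2 * pi * real m * real (n - m))) = 
       (2 / pi) * ((1 - p) ^ 2 * real n * real m / real (n - m))"
      using m d by (simp add: power2_eq_square field_simps)
    finally show ?thesis .
  qed
  also have "\<dots> \<le> sqrt (2 * real n * p * (1 - p) / pi + 4)"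
  proof (rule real_sqrt_le_mono)
    have q: "1 - p = b / real n" using n0 by (simp add: b_def)
    have "(1 - p) ^ 2 * real n * real m / real (n - m) = b ^ 2 * real m / (real n * real (n - m))"
      unfolding q using n0 d by (simp add: power2_eq_square)
    also have "\<dots> \<le> b ^ 2 * (a + 1) / (real n * (b - 1))"
      using m d n0 ab by (intro frac_le mult_left_mono mult_pos_pos) auto
    also have "\<dots> = b ^ 2 / (b - 1) * ((a + 1) / real n)" by simp
    \<comment> \<open>For \<open>b \<ge> 2\<close>,
      \<open>b ^ 2 \<le> (b + 2) * (b - 1)\<close>.\<close>
    also have "\<dots> \<le> (b + 2) * ((a + 1) / real n)"
      using ab n0 by (intro mult_right_mono) (auto simp: divide_simps power2_eq_square algebra_simps)
    also have "\<dots> = a * b / real n + (2 * a + b + 2) / real n"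
      by (simp add: algebra_simps flip: add_divide_distrib)
    also have "\<dots> \<le> a * b / real n + 4"
      using ab n0 by (simp add: divide_simps)
    also have "a * b / real n = real n * p * (1 - p)" using n0 by (simp add: a_def b_def)
    finally have "(2 / pi) * ((1 - p) ^ 2 * real n * real m / real (n - m)) \<le> (2 / pi) * (real n * p * (1 - p) + 4)"
      by (intro mult_left_mono) auto
    also have "\<dots> = 2 * real n * p * (1 - p) / pi + 8 / pi" by (simp add: field_simps)
    also have "8 / pi \<le> 4" using pi_gt3 by (simp add: field_simps)
    finally show "(2 / pi) * ((1 - p) ^ 2 * real n * real m / real (n - m)) \<le> 2 * real n * p * (1 - p) / pi + 4"
      by simp
  qed
  also have "\<dots> \<le> sqrt (2 * real n * p * (1 - p) / pi) + sqrt 4"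
    using p by (intro sqrt_add_le_add_sqrt) auto
  finally show ?thesis by simp
qed

subsection \<open>The centred count walk on a finite alphabet\<close>

text \<open>The factor 1/2 makes this \<open>t\<close> times the total variation distance when
  applied to the centred counts.\<close>

definition half_l1 :: "'a set \<Rightarrow> ('a \<Rightarrow> real) \<Rightarrow> real" where
  "half_l1 A s = (\<Sum>b\<in>A. \<bar>s b\<bar>) / 2"

definition walk_step :: "('a \<Rightarrow> real) \<Rightarrow> ('a \<Rightarrow> real) \<Rightarrow> 'a \<Rightarrow> ('a \<Rightarrow> real)" where
  "walk_step p s a = (\<lambda>b. s b + of_bool (b = a) - p b)"

text \<open>
  \<open>walk_exp A p \<phi> m s\<close> is the mean of \<open>\<phi>\<close> after \<open>m\<close> random steps from \<open>s\<close>; \<open>hit_prob A p v m s\<close> is the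
  probability that one of the positions visited, \<open>s\<close> included, has half-norm at least \<open>v\<close>.
\<close>

primrec walk_exp :: "'a set \<Rightarrow> ('a \<Rightarrow> real) \<Rightarrow> (('a \<Rightarrow> real) \<Rightarrow> real) \<Rightarrow> nat \<Rightarrow> ('a \<Rightarrow> real) \<Rightarrow> real" where
  "walk_exp A p \<phi> 0 s = \<phi> s"
| "walk_exp A p \<phi> (Suc m) s = (\<Sum>a\<in>A. p a * walk_exp A p \<phi> m (walk_step p s a))"

primrec hit_prob :: "'a set \<Rightarrow> ('a \<Rightarrow> real) \<Rightarrow> real \<Rightarrow> nat \<Rightarrow> ('a \<Rightarrow> real) \<Rightarrow> real" where
  "hit_prob A p v 0 s = of_bool (v \<le> half_l1 A s)"
| "hit_prob A p v (Suc m) s =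
     (if v \<le> half_l1 A s then 1 else \<Sum>a\<in>A. p a * hit_prob A p v m (walk_step p s a))"

lemma half_l1_triangle: "half_l1 A (\<lambda>b. s b + s' b) \<le> half_l1 A s + half_l1 A s'"
proof -
  have "(\<Sum>b\<in>A. \<bar>s b + s' b\<bar>) \<le> (\<Sum>b\<in>A. \<bar>s b\<bar> + \<bar>s' b\<bar>)"
    by (intro sum_mono abs_triangle_ineq)
  then show ?thesis by (simp add: half_l1_def sum.distrib flip: add_divide_distrib)
qed

lemma half_l1_lipschitz: "\<bar>half_l1 A s - half_l1 A s'\<bar> \<le> half_l1 A (\<lambda>b. s b - s' b)"
proof -
  have "half_l1 A (\<lambda>b. s b - s' b) = half_l1 A (\<lambda>b. s' b - s b)"
    by (simp add: half_l1_def abs_minus_commute)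
  then show ?thesis
    using half_l1_triangle[of A "\<lambda>b. s b - s' b" s'] half_l1_triangle[of A "\<lambda>b. s' b - s b" s] by simp
qed

section \<open>Submartingale property, bounded differences and mean of the walk\<close>

locale finite_distribution =
  fixes A :: "'a set" and p :: "'a \<Rightarrow> real"
  assumes finite_A: "finite A"
    and p_nonneg: "a \<in> A \<Longrightarrow> 0 \<le> p a"
    and sum_p: "(\<Sum>a\<in>A. p a) = 1"
begin

lemma A_nonempty: "A \<noteq> {}"
  using sum_p by auto

lemma p_le_1: "a \<in> A \<Longrightarrow> p a \<le> 1"
  using member_le_sum[of a A p] finite_A p_nonneg sum_p by auto

lemma sum_p_times_const: "(\<Sum>a\<in>A. p a * c) = c"
  by (simp add: sum_p flip: sum_distrib_right)

text \<open>The drift \<open>p\<close> cancels and only two unit vectors remain. This is the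
  bounded-difference constant in McDiarmid's argument.\<close>

lemma half_l1_step_diff_le_1:
  assumes "a \<in> A" "a' \<in> A"
  shows "half_l1 A (\<lambda>b. walk_step p s a b - walk_step p s a' b) \<le> 1"
proof -
  have "(\<Sum>b\<in>A. \<bar>walk_step p s a b - walk_step p s a' b\<bar>) \<le> (\<Sum>b\<in>A. of_bool (b = a) + of_bool (b = a'))"
    by (intro sum_mono) (auto simp: walk_step_def)
  also have "\<dots> = 2"
    using assms finite_A by (simp add: sum.distrib of_bool_def)
  finally show ?thesis by (simp add: half_l1_def)
qed

text \<open>Steps have mean zero, so \<open>s\<close> is the average of the next positions, and the
  absolute value is convex in each coordinate.\<close>

lemma half_l1_le_mean_step: "half_l1 A s \<le> (\<Sum>a\<in>A. p a * half_l1 A (walk_step p s a))"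
proof -
  have "\<bar>s b\<bar> \<le> (\<Sum>a\<in>A. p a * \<bar>walk_step p s a b\<bar>)" if "b \<in> A" for b
  proof -
    have "(\<Sum>a\<in>A. p a * walk_step p s a b) = (\<Sum>a\<in>A. p a * (s b - p b)) + (\<Sum>a\<in>A. p a * of_bool (b = a))"
      by (simp add: walk_step_def algebra_simps flip: sum.distrib)
    also have "(\<Sum>a\<in>A. p a * of_bool (b = a)) = p b"
      using that finite_A by (simp add: of_bool_def if_distrib cong: if_cong)
    also have "(\<Sum>a\<in>A. p a * (s b - p b)) = s b - p b" by (rule sum_p_times_const)
    finally have "s b = (\<Sum>a\<in>A. p a * walk_step p s a b)" by simp
    then have "\<bar>s b\<bar> \<le> (\<Sum>a\<in>A. \<bar>p a * walk_step p s a b\<bar>)" by simp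
    also have "\<dots> = (\<Sum>a\<in>A. p a * \<bar>walk_step p s a b\<bar>)"
      by (intro sum.cong refl) (simp add: abs_mult p_nonneg)
    finally show ?thesis .
  qed
  then have "(\<Sum>b\<in>A. \<bar>s b\<bar>) \<le> (\<Sum>b\<in>A. \<Sum>a\<in>A. p a * \<bar>walk_step p s a b\<bar>)"
    by (rule sum_mono)
  also have "\<dots> = (\<Sum>a\<in>A. p a * (\<Sum>b\<in>A. \<bar>walk_step p s a b\<bar>))"
    by (subst sum.swap) (simp add: sum_distrib_left)
  finally show ?thesis
    by (simp add: half_l1_def flip: sum_divide_distrib)
qed

text \<open>The submartingale property passes to the exponential by Jensen's inequality, then
  iterates over the steps.\<close>

lemma exp_half_l1_le_walk_exp:
  assumes "0 \<le> c"
  shows "exp (c * half_l1 A s) \<le> walk_exp A p (\<lambda>s. exp (c * half_l1 A s)) m s"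
proof (induction m arbitrary: s)
  case (Suc m)
  have "exp (c * half_l1 A s) \<le> exp (c * (\<Sum>a\<in>A. p a * half_l1 A (walk_step p s a)))"
    using half_l1_le_mean_step assms by (simp add: mult_left_mono)
  also have "\<dots> = exp (\<Sum>a\<in>A. p a *\<^sub>R (c * half_l1 A (walk_step p s a)))"
    by (simp add: sum_distrib_left mult_ac)
  also have "\<dots> \<le> (\<Sum>a\<in>A. p a * exp (c * half_l1 A (walk_step p s a)))"
    using finite_A A_nonempty p_nonneg sum_p
    by (intro convex_on_sum[OF _ _ exp_convex]) auto
  also have "\<dots> \<le> walk_exp A p (\<lambda>s. exp (c * half_l1 A s)) (Suc m) s"
    by (auto intro!: sum_mono mult_left_mono Suc p_nonneg)
  finally show ?case .
qed simp

text \<open>Doob's maximal inequality, in recursive form.\<close>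

lemma hit_prob_le_walk_exp:
  assumes "0 \<le> c"
  shows "hit_prob A p v m s \<le> exp (- c * v) * walk_exp A p (\<lambda>s. exp (c * half_l1 A s)) m s"
proof (induction m arbitrary: s)
  case 0
  then show ?case using assms by (simp add: mult_left_mono flip: exp_add)
next
  case (Suc m)
  show ?case
  proof (cases "v \<le> half_l1 A s")
    case True
    \<comment> \<open>The level is already reached, so the bound has to be at least 1; the
      submartingale property carries this to the last step.\<close>
    then have "1 \<le> exp (- c * v) * exp (c * half_l1 A s)"
      using assms by (simp add: mult_left_mono flip: exp_add)
    also have "\<dots> \<le> exp (- c * v) * walk_exp A p (\<lambda>s. exp (c * half_l1 A s)) (Suc m) s"
      using exp_half_l1_le_walk_exp[OF assms, of s "Suc m"] by (intro mult_left_mono) auto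
    finally show ?thesis using True by simp
  next
    case False
    then have "hit_prob A p v (Suc m) s = (\<Sum>a\<in>A. p a * hit_prob A p v m (walk_step p s a))" by simp
    also have "\<dots> \<le> (\<Sum>a\<in>A. p a * (exp (- c * v) * walk_exp A p (\<lambda>s. exp (c * half_l1 A s)) m (walk_step p s a)))"
      by (intro sum_mono mult_left_mono Suc p_nonneg)
    also have "\<dots> = exp (- c * v) * walk_exp A p (\<lambda>s. exp (c * half_l1 A s)) (Suc m) s"
      by (simp add: sum_distrib_left mult_ac)
    finally show ?thesis .
  qed
qed

text \<open>Coupling: two walks driven by the same samples keep their initial difference.\<close>

lemma walk_exp_lipschitz:
  "\<bar>walk_exp A p (half_l1 A) m s - walk_exp A p (half_l1 A) m s'\<bar> \<le> half_l1 A (\<lambda>b. s b - s' b)"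
proof (induction m arbitrary: s s')
  case 0
  then show ?case by (simp add: half_l1_lipschitz)
next
  case (Suc m)
  let ?w = "walk_exp A p (half_l1 A) m"
  have "\<bar>walk_exp A p (half_l1 A) (Suc m) s - walk_exp A p (half_l1 A) (Suc m) s'\<bar>
     = \<bar>\<Sum>a\<in>A. p a * (?w (walk_step p s a) - ?w (walk_step p s' a))\<bar>"
    by (simp add: sum_subtractf right_diff_distrib)
  also have "\<dots> \<le> (\<Sum>a\<in>A. p a * half_l1 A (\<lambda>b. s b - s' b))"
  proof (rule sum_abs[THEN order_trans], rule sum_mono)
    fix a assume a: "a \<in> A"
    have "(\<lambda>b. walk_step p s a b - walk_step p s' a b) = (\<lambda>b. s b - s' b)"
      by (simp add: walk_step_def fun_eq_iff)
    then show "\<bar>p a * (?w (walk_step p s a) - ?w (walk_step p s' a))\<bar> \<le> p a * half_l1 A (\<lambda>b. s b - s' b)"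
      using Suc[of "walk_step p s a" "walk_step p s' a"] a
      by (simp add: abs_mult p_nonneg mult_left_mono)
  qed
  finally show ?case by (simp only: sum_p_times_const)
qed

text \<open>Hoeffding's lemma for an interval of length 1, carried over to finite sums by realising
  \<open>p\<close> as a probability mass function.\<close>

lemma hoeffding_finite:
  assumes c: "0 < c" and ab: "\<And>a. a \<in> A \<Longrightarrow> l \<le> f a" "\<And>a. a \<in> A \<Longrightarrow> f a \<le> l + 1"
  shows "(\<Sum>a\<in>A. p a * exp (c * f a)) \<le> exp (c * (\<Sum>a\<in>A. p a * f a) + c\<^sup>2 / 8)"
proof -
  define P where "P = embed_pmf (\<lambda>a. if a \<in> A then p a else 0)"
  have pmf: "pmf P a = (if a \<in> A then p a else 0)" for a
    unfolding P_def
  proof (rule pmf_embed_pmf)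
    have "(\<integral>\<^sup>+ a. ennreal (if a \<in> A then p a else 0) \<partial>count_space UNIV) = (\<Sum>a\<in>A. ennreal (p a))"
      using finite_A by (subst nn_integral_count_space'[where A = A]) auto
    also have "\<dots> = 1" by (simp add: sum_ennreal p_nonneg sum_p)
    finally show "(\<integral>\<^sup>+ a. ennreal (if a \<in> A then p a else 0) \<partial>count_space UNIV) = 1" .
  qed (simp add: p_nonneg)
  have sub: "set_pmf P \<subseteq> A" by (auto simp: set_pmf_eq pmf split: if_splits)
  interpret interval_bounded_random_variable "measure_pmf P" f l "l + 1"
    by standard (use ab sub in \<open>auto simp: AE_measure_pmf_iff\<close>)
  have E: "measure_pmf.expectation P g = (\<Sum>a\<in>A. p a * g a)" for g :: "'a \<Rightarrow> real"
    using integral_measure_pmf[OF finite_A, of P g] sub by (auto simp: pmf intro!: sum.cong)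
  define \<mu> where "\<mu> = measure_pmf.expectation P f"
  have "ennreal (measure_pmf.expectation P (\<lambda>x. exp (c * (f x - \<mu>)))) =
     nn_integral P (\<lambda>x. exp (c * (f x - \<mu>)))"
    by (subst nn_integral_eq_integral) (auto intro!: integrable_measure_pmf_finite finite_subset[OF sub finite_A])
  also have "\<dots> \<le> ennreal (exp (c\<^sup>2 * (l + 1 - l)\<^sup>2 / 8))"
    unfolding \<mu>_def by (rule Hoeffdings_lemma_nn_integral[OF c])
  finally have "(\<Sum>a\<in>A. p a * exp (c * (f a - \<mu>))) \<le> exp (c\<^sup>2 / 8)"
    by (simp add: E)
  then have "exp (c * \<mu>) * (\<Sum>a\<in>A. p a * exp (c * (f a - \<mu>))) \<le> exp (c * \<mu>) * exp (c\<^sup>2 / 8)"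
    by (intro mult_left_mono) auto
  also have "exp (c * \<mu>) * (\<Sum>a\<in>A. p a * exp (c * (f a - \<mu>))) = (\<Sum>a\<in>A. p a * exp (c * f a))"
    by (simp add: sum_distrib_left mult.left_commute right_diff_distrib flip: exp_add)
  finally show ?thesis by (simp add: \<mu>_def E exp_add)
qed

text \<open>McDiarmid's argument: given the first letter, the mean of the final half-norm varies by
  at most 1, by coupling and the bounded difference of steps. Hoeffding's lemma therefore charges
  \<open>c\<^sup>2 / 8\<close> per step.\<close>

lemma walk_exp_exp_le:
  assumes c: "0 < c"
  shows "walk_exp A p (\<lambda>s. exp (c * half_l1 A s)) m s \<le>
    exp (c * walk_exp A p (half_l1 A) m s + real m * c\<^sup>2 / 8)"
proof (induction m arbitrary: s)
  case (Suc m)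
  let ?w = "\<lambda>a. walk_exp A p (half_l1 A) m (walk_step p s a)"
  define l where "l = Min (?w ` A)"
  have l1: "l \<le> ?w a" if "a \<in> A" for a
    using that finite_A by (simp add: l_def)
  obtain a0 where a0: "a0 \<in> A" "l = ?w a0"
    using Min_in[of "?w ` A"] finite_A A_nonempty unfolding l_def by (metis (no_types, lifting) finite_imageI image_iff image_is_empty)
  have l2: "?w a \<le> l + 1" if "a \<in> A" for a
    using walk_exp_lipschitz[of m "walk_step p s a" "walk_step p s a0"]
      half_l1_step_diff_le_1[OF that a0(1), of s] a0(2) by linarith
  have "walk_exp A p (\<lambda>s. exp (c * half_l1 A s)) (Suc m) s
      \<le> (\<Sum>a\<in>A. p a * exp (c * ?w a + real m * c\<^sup>2 / 8))"
    by (auto intro!: sum_mono mult_left_mono Suc p_nonneg)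
  also have "\<dots> = (\<Sum>a\<in>A. p a * exp (c * ?w a)) * exp (real m * c\<^sup>2 / 8)"
    by (simp add: exp_add sum_distrib_right mult.assoc)
  also have "\<dots> \<le> exp (c * (\<Sum>a\<in>A. p a * ?w a) + c\<^sup>2 / 8) * exp (real m * c\<^sup>2 / 8)"
    by (intro mult_right_mono hoeffding_finite[OF c l1 l2]) auto
  also have "\<dots> = exp (c * walk_exp A p (half_l1 A) (Suc m) s + real (Suc m) * c\<^sup>2 / 8)"
    by (simp add: algebra_simps add_divide_distrib flip: exp_add)
  finally show ?case .
qed simp

lemma hit_prob_le:
  assumes m: "0 < m" and w: "0 < w" and v: "walk_exp A p (half_l1 A) m s + w \<le> v"
  shows "hit_prob A p v m s \<le> exp (- 2 * w\<^sup>2 / real m)"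
proof -
  \<comment> \<open>Minimiser of the Chernoff exponent
    \<open>- c * w + m * c\<^sup>2 / 8\<close>.\<close>
  define c where "c = 4 * w / real m"
  have c: "0 < c" using m w by (simp add: c_def)
  have "hit_prob A p v m s \<le> exp (- c * v) * walk_exp A p (\<lambda>s. exp (c * half_l1 A s)) m s"
    using c by (intro hit_prob_le_walk_exp) simp
  also have "\<dots> \<le> exp (- c * v) * exp (c * walk_exp A p (half_l1 A) m s + real m * c\<^sup>2 / 8)"
    using walk_exp_exp_le[OF c] by simp
  also have "\<dots> = exp (- c * (v - walk_exp A p (half_l1 A) m s) + real m * c\<^sup>2 / 8)"
    by (simp add: algebra_simps flip: exp_add)
  also have "\<dots> \<le> exp (- c * w + real m * c\<^sup>2 / 8)"
    using c v by simp
  also have "- c * w + real m * c\<^sup>2 / 8 = - 2 * w\<^sup>2 / real m"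
    using m by (simp add: c_def power2_eq_square)
  finally show ?thesis .
qed

text \<open>The half-norm is additive over letters, and the count of each letter \<open>b\<close> is
  binomial with parameter \<open>p b\<close>. The start \<open>s\<close> is arbitrary because the
  induction moves it by the first step.\<close>

lemma walk_exp_half_l1_eq:
  "walk_exp A p (half_l1 A) m s =
    (\<Sum>b\<in>A. \<Sum>i\<le>m. binom_weight m (p b) i * \<bar>s b + real i - real m * p b\<bar>) / 2"
proof (induction m arbitrary: s)
  case 0
  then show ?case by (simp add: half_l1_def binom_weight_def)
next
  case (Suc m)
  \<comment> \<open>\<open>x\<close> records whether the first sample is \<open>b\<close>: it is 1
    with probability \<open>p b\<close> and 0 otherwise.\<close>
  define G where "G = (\<lambda>b x. \<Sum>i\<le>m. binom_weight m (p b) i * \<bar>s b + x + real i - real (Suc m) * p b\<bar>)"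
  have "walk_exp A p (half_l1 A) (Suc m) s = (\<Sum>a\<in>A. p a * ((\<Sum>b\<in>A. G b (of_bool (b = a))) / 2))"
    unfolding walk_exp.simps Suc G_def walk_step_def by (simp add: algebra_simps)
  also have "\<dots> = (\<Sum>b\<in>A. \<Sum>a\<in>A. p a * G b (of_bool (b = a))) / 2"
    by (subst sum.swap) (simp add: sum_distrib_left sum_divide_distrib)
  also have "(\<Sum>b\<in>A. \<Sum>a\<in>A. p a * G b (of_bool (b = a))) = (\<Sum>b\<in>A. p b * G b 1 + (1 - p b) * G b 0)"
  proof (rule sum.cong[OF refl])
    fix b assume b: "b \<in> A"
    have "(\<Sum>a\<in>A. p a * G b (of_bool (b = a))) = (\<Sum>a\<in>A. (if b = a then p a * (G b 1 - G b 0) else 0) + p a * G b 0)"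
      by (intro sum.cong refl) (auto simp: algebra_simps)
    also have "\<dots> = p b * (G b 1 - G b 0) + G b 0"
      using b finite_A by (simp add: sum.distrib sum_p_times_const)
    finally show "(\<Sum>a\<in>A. p a * G b (of_bool (b = a))) = p b * G b 1 + (1 - p b) * G b 0"
      by (simp add: algebra_simps)
  qed
  also have "\<dots> = (\<Sum>b\<in>A. \<Sum>i\<le>Suc m. binom_weight (Suc m) (p b) i * \<bar>s b + real i - real (Suc m) * p b\<bar>)"
    by (intro sum.cong refl) (simp only: sum_binom_weight_Suc G_def add_0_right add_0_left of_nat_Suc add_ac)
  finally show ?case .
qed

lemma walk_exp_half_l1_0:
  "walk_exp A p (half_l1 A) m (\<lambda>_. 0) = (\<Sum>b\<in>A. binom_mad m (p b)) / 2"
  by (simp add: walk_exp_half_l1_eq binom_mad_def)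

text \<open>For \<open>m < card A\<close> the linear deviation bound gives the mean bound
  \<open>m\<close>. Otherwise the additive constants 4 sum, after halving, to
  \<open>2 * card A\<close>. Both are at most the power term, and Cauchy-Schwarz over the letters
  yields the square root.\<close>

lemma walk_exp_half_l1_0_le:
  "walk_exp A p (half_l1 A) m (\<lambda>_. 0) \<le>
    sqrt (real (card A) * real m / (2 * pi)) + 2 * (real (card A) powr (3/4) * real m powr (1/4))"
proof -
  let ?k = "real (card A)" and ?m = "real m"
  have pw: "x = x powr (3/4) * x powr (1/4)" if "x \<ge> 0" for x :: real
    using that by (simp flip: powr_add)
  show ?thesis
  proof (cases "m < card A")
    case True
    have "(\<Sum>b\<in>A. binom_mad m (p b)) \<le> (\<Sum>b\<in>A. p b * (2 * ?m))"
    proof (rule sum_mono)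
      fix b assume b: "b \<in> A"
      have "binom_mad m (p b) \<le> 2 * ?m * p b * (1 - p b)"
        using b by (intro binom_mad_le_linear p_nonneg p_le_1)
      also have "\<dots> \<le> 2 * ?m * p b * 1"
        using b by (intro mult_left_mono) (auto simp: p_nonneg)
      finally show "binom_mad m (p b) \<le> p b * (2 * ?m)" by (simp add: mult_ac)
    qed
    also have "\<dots> = 2 * ?m" by (rule sum_p_times_const)
    finally have "walk_exp A p (half_l1 A) m (\<lambda>_. 0) \<le> ?m"
      by (simp add: walk_exp_half_l1_0)
    also have "?m = ?m powr (3/4) * ?m powr (1/4)" by (rule pw) simp
    also have "\<dots> \<le> ?k powr (3/4) * ?m powr (1/4)"
      using True by (intro mult_right_mono powr_mono2) auto
    also have "\<dots> \<le> 2 * (?k powr (3/4) * ?m powr (1/4))" by simp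
    also have "\<dots> \<le> sqrt (?k * ?m / (2 * pi)) + 2 * (?k powr (3/4) * ?m powr (1/4))" by simp
    finally show ?thesis .
  next
    case False
    have "(\<Sum>b\<in>A. binom_mad m (p b)) \<le> (\<Sum>b\<in>A. sqrt (2 * ?m * p b / pi) + 4)"
    proof (rule sum_mono)
      fix b assume b: "b \<in> A"
      have "binom_mad m (p b) \<le> sqrt (2 * ?m * p b * (1 - p b) / pi) + 4"
        using b by (intro binom_mad_le p_nonneg p_le_1)
      also have "2 * ?m * p b * (1 - p b) / pi \<le> 2 * ?m * p b * 1 / pi"
        using b by (intro divide_right_mono mult_left_mono) (auto simp: p_nonneg)
      finally show "binom_mad m (p b) \<le> sqrt (2 * ?m * p b / pi) + 4" by simp
    qed
    also have "\<dots> = (\<Sum>b\<in>A. sqrt (2 * ?m * p b / pi)) + 4 * ?k"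
      by (simp add: sum.distrib)
    also have "(\<Sum>b\<in>A. sqrt (2 * ?m * p b / pi)) \<le> sqrt (2 * ?k * ?m / pi)"
    proof (rule real_le_rsqrt)
      have "(\<Sum>b\<in>A. sqrt (2 * ?m * p b / pi))\<^sup>2 \<le> (\<Sum>b\<in>A. (sqrt (2 * ?m * p b / pi))\<^sup>2) * ?k"
        by (rule sum_squared_le_sum_of_squares)
      also have "(\<Sum>b\<in>A. (sqrt (2 * ?m * p b / pi))\<^sup>2) = (\<Sum>b\<in>A. p b * (2 * ?m / pi))"
        by (intro sum.cong refl) (simp add: p_nonneg)
      also have "\<dots> = 2 * ?m / pi" by (rule sum_p_times_const)
      finally show "(\<Sum>b\<in>A. sqrt (2 * ?m * p b / pi))\<^sup>2 \<le> 2 * ?k * ?m / pi"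
        by (simp add: mult_ac)
    qed
    also have "sqrt (2 * ?k * ?m / pi) = 2 * sqrt (?k * ?m / (2 * pi))"
    proof -
      have "2 * ?k * ?m / pi = 4 * (?k * ?m / (2 * pi))" by simp
      then show ?thesis by (simp only: real_sqrt_mult real_sqrt_four)
    qed
    finally have "walk_exp A p (half_l1 A) m (\<lambda>_. 0) \<le> sqrt (?k * ?m / (2 * pi)) + 2 * ?k"
      by (simp add: walk_exp_half_l1_0)
    moreover have "?k \<le> ?k powr (3/4) * ?m powr (1/4)"
      using False by (subst pw[of ?k]) (auto intro!: mult_left_mono powr_mono2)
    ultimately show ?thesis by linarith
  qed
qed

end

subsection \<open>Transfer to i.i.d. samples\<close>

definition centred_counts :: "('a \<Rightarrow> real) \<Rightarrow> (nat \<Rightarrow> 'a) \<Rightarrow> nat \<Rightarrow> 'a \<Rightarrow> real" where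
  "centred_counts p x t = (\<lambda>b. (\<Sum>i=1..t. of_bool (x i = b)) - real t * p b)"

lemma centred_counts_Suc:
  "centred_counts p x (Suc t) = walk_step p (centred_counts p x t) (x (Suc t))"
  by (auto simp: centred_counts_def walk_step_def fun_eq_iff algebra_simps)

lemma centred_counts_cong:
  assumes "\<And>i. 1 \<le> i \<Longrightarrow> i \<le> t \<Longrightarrow> x i = y i"
  shows "centred_counts p x t = centred_counts p y t"
  using assms by (simp add: centred_counts_def fun_eq_iff)

locale iid_sample = finite_distribution A p + prob_space M
  for A :: "'a set" and p :: "'a \<Rightarrow> real" and M :: "'w measure" +
  fixes P :: "'a measure" and X :: "nat \<Rightarrow> 'w \<Rightarrow> 'a"
  assumes singletons: "a \<in> A \<Longrightarrow> {a} \<in> sets P"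
    and indep: "indep_vars (\<lambda>_. P) X {1..}"
    and prob_eq: "1 \<le> i \<Longrightarrow> a \<in> A \<Longrightarrow> prob (X i -` {a} \<inter> space M) = p a"
begin

section \<open>Measurability and probabilities of sample events\<close>

lemma A_sets: "A \<in> sets P"
  using sets.finite_UN[of A "\<lambda>a. {a}" P] finite_A singletons by simp

lemma X_measurable: "1 \<le> i \<Longrightarrow> X i \<in> measurable M P"
  using indep by (auto simp: indep_vars_def)

lemma X_in_sets: "1 \<le> i \<Longrightarrow> {\<omega> \<in> space M. X i \<omega> \<in> A} \<in> events"
  using measurable_sets[OF X_measurable A_sets, of i] by (simp add: vimage_def Int_def conj_commute)

lemma X_eq_sets: "1 \<le> i \<Longrightarrow> a \<in> A \<Longrightarrow> {\<omega> \<in> space M. X i \<omega> = a} \<in> events"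
  using measurable_sets[OF X_measurable singletons, of i a] by (simp add: vimage_def Int_def conj_commute)

lemma half_l1_measurable: "(\<lambda>\<omega>. half_l1 A (centred_counts p (\<lambda>i. X i \<omega>) t)) \<in> borel_measurable M"
proof -
  have "(\<lambda>\<omega>. of_bool (X i \<omega> = b) :: real) \<in> borel_measurable M" if "1 \<le> i" "b \<in> A" for i b
  proof -
    have "(indicator {\<omega> \<in> space M. X i \<omega> = b} :: _ \<Rightarrow> real) \<in> borel_measurable M"
      using X_eq_sets[OF that] by simp
    then show ?thesis by (rule measurable_cong[THEN iffD1, rotated]) (simp add: indicator_def of_bool_def)
  qed
  then show ?thesis
    unfolding half_l1_def centred_counts_def
    by (intro borel_measurable_divide borel_measurable_sum borel_measurable_abs borel_measurable_diff) auto
qed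

lemma hit_sets: "{\<omega> \<in> space M. v \<le> half_l1 A (centred_counts p (\<lambda>i. X i \<omega>) t)} \<in> events"
  using half_l1_measurable by simp

lemma prefix_sets:
  assumes "f \<in> {1..i} \<rightarrow> A"
  shows "{\<omega> \<in> space M. \<forall>j\<in>{1..i}. X j \<omega> = f j} \<in> events"
  using assms by (intro sets.sets_Collect_finite_All X_eq_sets) auto

lemma prob_prefix:
  assumes f: "f \<in> {1..i} \<rightarrow> A"
  shows "prob {\<omega> \<in> space M. \<forall>j\<in>{1..i}. X j \<omega> = f j} = (\<Prod>j=1..i. p (f j))"
\<comment> \<open>The product rule is applied to a non-empty index set; the empty prefix is the
  whole space.\<close>
proof (cases "i = 0")
  case True
  then show ?thesis by (simp add: prob_space)
next
  case False
  have "{\<omega> \<in> space M. \<forall>j\<in>{1..i}. X j \<omega> = f j} = (\<Inter>j\<in>{1..i}. X j -` {f j} \<inter> space M)"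
    using False by auto
  also have "prob \<dots> = (\<Prod>j\<in>{1..i}. prob (X j -` {f j} \<inter> space M))"
    using False f by (intro indep_varsD[OF indep] singletons) auto
  also have "\<dots> = (\<Prod>j=1..i. p (f j))"
    using f by (intro prod.cong refl prob_eq) auto
  finally show ?thesis .
qed

text \<open>The first \<open>i\<close> samples are pinned to \<open>f\<close> and \<open>m\<close>
  more are free, as in the recursion of \<open>hit_prob\<close>. Free samples are confined to
  \<open>A\<close>, because the recursion sums over letters only.\<close>

definition hit_event :: "real \<Rightarrow> nat \<Rightarrow> nat \<Rightarrow> (nat \<Rightarrow> 'a) \<Rightarrow> 'w set" where
  "hit_event v i m f = {\<omega> \<in> space M. (\<forall>j\<in>{1..i}. X j \<omega> = f j) \<and> (\<forall>j\<in>{i<..i + m}. X j \<omega> \<in> A) \<and>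
     (\<exists>t\<in>{i..i + m}. v \<le> half_l1 A (centred_counts p (\<lambda>i. X i \<omega>) t))}"

lemma hit_event_sets:
  assumes "f \<in> {1..i} \<rightarrow> A"
  shows "hit_event v i m f \<in> events"
  unfolding hit_event_def
  by (intro sets.sets_Collect_conj prefix_sets assms sets.sets_Collect_finite_All
      sets.sets_Collect_finite_Ex X_in_sets hit_sets) auto

text \<open>Induction on the number of free samples: splitting on the next letter reproduces the
  recursion of \<open>hit_prob\<close>, and independence turns the pinned prefix into a product. As
  only an upper bound is claimed, a union bound over letters suffices.\<close>

lemma prob_hit_event_le:
  assumes "f \<in> {1..i} \<rightarrow> A"
  shows "prob (hit_event v i m f) \<le> (\<Prod>j=1..i. p (f j)) * hit_prob A p v m (centred_counts p f i)"
  using assms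
proof (induction m arbitrary: i f)
  case (0 i f)
  have c: "centred_counts p (\<lambda>i. X i \<omega>) i = centred_counts p f i" if "\<forall>j\<in>{1..i}. X j \<omega> = f j" for \<omega>
    using that by (intro centred_counts_cong) auto
  show ?case
  proof (cases "v \<le> half_l1 A (centred_counts p f i)")
    case True
    have "prob (hit_event v i 0 f) \<le> prob {\<omega> \<in> space M. \<forall>j\<in>{1..i}. X j \<omega> = f j}"
      by (intro finite_measure_mono prefix_sets 0) (auto simp: hit_event_def)
    also have "\<dots> = (\<Prod>j=1..i. p (f j))" by (rule prob_prefix[OF 0])
    finally show ?thesis using True by simp
  next
    case False
    then have "hit_event v i 0 f = {}" using c by (auto simp: hit_event_def)
    with False show ?thesis by simp
  qed
next
  case (Suc m i f)
  show ?case
  proof (cases "v \<le> half_l1 A (centred_counts p f i)")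
    case True
    have "prob (hit_event v i (Suc m) f) \<le> prob {\<omega> \<in> space M. \<forall>j\<in>{1..i}. X j \<omega> = f j}"
      by (intro finite_measure_mono prefix_sets Suc) (auto simp: hit_event_def)
    also have "\<dots> = (\<Prod>j=1..i. p (f j))" by (rule prob_prefix[OF Suc.prems])
    finally show ?thesis using True by simp
  next
    case False
    define g where "g = (\<lambda>a. f(Suc i := a))"
    have g: "g a \<in> {1..Suc i} \<rightarrow> A" if "a \<in> A" for a
      using Suc.prems that by (auto simp: g_def)
    have ev: "hit_event v (Suc i) m (g a) \<in> events" if "a \<in> A" for a
      by (rule hit_event_sets[OF g[OF that]])
    have "hit_event v i (Suc m) f \<subseteq> (\<Union>a\<in>A. hit_event v (Suc i) m (g a))"
    proof
      fix \<omega> assume \<omega>: "\<omega> \<in> hit_event v i (Suc m) f"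
      then have pre: "\<forall>j\<in>{1..i}. X j \<omega> = f j" and inA: "\<forall>j\<in>{i<..i + Suc m}. X j \<omega> \<in> A"
        by (auto simp: hit_event_def)
      obtain t where t: "t \<in> {i..i + Suc m}" "v \<le> half_l1 A (centred_counts p (\<lambda>i. X i \<omega>) t)"
        using \<omega> by (auto simp: hit_event_def)
      have "centred_counts p (\<lambda>i. X i \<omega>) i = centred_counts p f i"
        using pre by (intro centred_counts_cong) auto
      \<comment> \<open>The level is not reached at time \<open>i\<close>, so the hit falls into the
        window of the longer prefix.\<close>
      then have "t \<noteq> i" using t(2) False by auto
      then have t': "t \<in> {Suc i..Suc i + m}" using t(1) by auto
      have "\<omega> \<in> hit_event v (Suc i) m (g (X (Suc i) \<omega>))"
        unfolding hit_event_def
      proof (intro CollectI conjI)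
        show "\<omega> \<in> space M" using \<omega> by (simp add: hit_event_def)
        show "\<forall>j\<in>{1..Suc i}. X j \<omega> = g (X (Suc i) \<omega>) j"
          using pre by (auto simp: g_def)
        show "\<forall>j\<in>{Suc i<..Suc i + m}. X j \<omega> \<in> A" using inA by auto
        show "\<exists>t\<in>{Suc i..Suc i + m}. v \<le> half_l1 A (centred_counts p (\<lambda>i. X i \<omega>) t)"
          using t' t(2) by blast
      qed
      moreover have "X (Suc i) \<omega> \<in> A" using inA by auto
      ultimately show "\<omega> \<in> (\<Union>a\<in>A. hit_event v (Suc i) m (g a))" by auto
    qed
    then have "prob (hit_event v i (Suc m) f) \<le> prob (\<Union>a\<in>A. hit_event v (Suc i) m (g a))"
      using finite_A ev by (intro finite_measure_mono sets.finite_UN) auto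
    also have "\<dots> \<le> (\<Sum>a\<in>A. prob (hit_event v (Suc i) m (g a)))"
      using finite_A ev by (intro finite_measure_subadditive_finite) auto
    also have "\<dots> \<le> (\<Sum>a\<in>A. (\<Prod>j=1..Suc i. p (g a j)) * hit_prob A p v m (centred_counts p (g a) (Suc i)))"
      using g by (intro sum_mono Suc.IH) auto
    also have "\<dots> = (\<Sum>a\<in>A. (\<Prod>j=1..i. p (f j)) * (p a * hit_prob A p v m (walk_step p (centred_counts p f i) a)))"
    proof (rule sum.cong[OF refl])
      fix a
      have "(\<Prod>j=1..i. p (g a j)) = (\<Prod>j=1..i. p (f j))"
        by (intro prod.cong) (auto simp: g_def)
      moreover have "centred_counts p (g a) i = centred_counts p f i"
        by (intro centred_counts_cong) (auto simp: g_def)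
      ultimately show "(\<Prod>j=1..Suc i. p (g a j)) * hit_prob A p v m (centred_counts p (g a) (Suc i)) =
        (\<Prod>j=1..i. p (f j)) * (p a * hit_prob A p v m (walk_step p (centred_counts p f i) a))"
        by (simp add: centred_counts_Suc g_def)
    qed
    finally show ?thesis using False by (simp add: sum_distrib_left)
  qed
qed

lemma hit_event_0:
  "hit_event v 0 m f = {\<omega> \<in> space M. (\<forall>j\<in>{1..m}. X j \<omega> \<in> A) \<and>
     (\<exists>t\<le>m. v \<le> half_l1 A (centred_counts p (\<lambda>i. X i \<omega>) t))}"
  by (simp add: hit_event_def Bex_def Ball_def Suc_le_eq)

lemma prob_hit_event_0_le: "prob (hit_event v 0 m f) \<le> hit_prob A p v m (\<lambda>_. 0)"
  using prob_hit_event_le[of f 0 v m] by (simp add: centred_counts_def)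

end

subsection \<open>Dyadic epochs\<close>

lemma tv_dist_empirical_measure:
  assumes "\<And>a. a \<in> A \<Longrightarrow> {a} \<in> sets P" and "1 \<le> t"
  shows "real t * tv_dist A (empirical_measure P X t \<omega>) P =
    half_l1 A (centred_counts (\<lambda>a. measure P {a}) (\<lambda>i. X i \<omega>) t)"
proof -
  have "real t * \<bar>measure (empirical_measure P X t \<omega>) {a} - measure P {a}\<bar> =
     \<bar>centred_counts (\<lambda>a. measure P {a}) (\<lambda>i. X i \<omega>) t a\<bar>" if "a \<in> A" for a
  proof -
    have "(\<Sum>i=1..t. indicator {a} (X i \<omega>)) = (\<Sum>i=1..t. of_bool (X i \<omega> = a) :: real)"
      by (intro sum.cong refl) (simp add: indicator_def)
    then have "centred_counts (\<lambda>a. measure P {a}) (\<lambda>i. X i \<omega>) t a =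
        real t * (measure (empirical_measure P X t \<omega>) {a} - measure P {a})"
      using assms(2) measure_empirical_measure[OF assms(1)[OF that], of X t \<omega>]
      by (simp add: centred_counts_def right_diff_distrib)
    then show ?thesis by (simp add: abs_mult)
  qed
  then have "(\<Sum>a\<in>A. real t * \<bar>measure (empirical_measure P X t \<omega>) {a} - measure P {a}\<bar>) =
     (\<Sum>a\<in>A. \<bar>centred_counts (\<lambda>a. measure P {a}) (\<lambda>i. X i \<omega>) t a\<bar>)"
    by (rule sum.cong[OF refl])
  then show ?thesis
    by (simp add: tv_dist_def half_l1_def flip: sum_distrib_left)
qed

text \<open>
  The left-hand side is the mean bound for \<open>N = 2 n\<close> steps plus the deviation that has probability
  \<open>\<delta> / l (j + 1)\<close>. Monotonicity of \<open>2 powr (- u) * ln (l u)\<close> replaces \<open>l (log 2 t)\<close> by \<open>l (j + 1)\<close>.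
\<close>

lemma epoch_threshold_le:
  fixes l :: "real \<Rightarrow> real" and k t n :: real and j :: nat
  assumes n: "n = 2 ^ j" and t: "n \<le> t" "t \<le> 2 * n" and k: "0 \<le> k"
    and l_ge_1: "\<And>x. x \<ge> 0 \<Longrightarrow> l x \<ge> 1"
    and l_const: "\<And>x. 0 \<le> x \<Longrightarrow> x \<le> 1 \<Longrightarrow> l x = l 1"
    and l_decr: "antimono_on {1..} (\<lambda>u. 2 powr (- u) * ln (l u))"
    and \<delta>: "0 < \<delta>" "\<delta> < 1"
  shows "sqrt (k * (2 * n) / (2 * pi)) + 2 * (k powr (3/4) * (2 * n) powr (1/4))
      + sqrt (n * (ln (l (real (Suc j))) + ln (1 / \<delta>)))
    \<le> t * (sqrt (k / (pi * t)) + 2 * (2 * k / t) powr (3/4)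
        + 2 * sqrt (2 / t * (ln (l (log 2 t)) + ln (1 / \<delta>))))"
proof -
  have n0: "n \<ge> 1" using n by simp
  then have t0: "t \<ge> 1" using t by simp
  have mult_sqrt: "t * sqrt x = sqrt (t\<^sup>2 * x)" for x
    using t0 by (simp add: real_sqrt_mult)
  have "sqrt (k * (2 * n) / (2 * pi)) \<le> sqrt (k * t / pi)"
    using t k by (simp add: divide_right_mono mult_left_mono)
  also have "\<dots> = t * sqrt (k / (pi * t))"
    unfolding mult_sqrt using t0 by (simp add: power2_eq_square mult.commute)
  finally have 1: "sqrt (k * (2 * n) / (2 * pi)) \<le> t * sqrt (k / (pi * t))" .
  have "k powr (3/4) * (2 * n) powr (1/4) = 2 powr (1/4) * k powr (3/4) * n powr (1/4)"
    using n0 by (simp add: powr_mult)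
  \<comment> \<open>The factor 2 inside \<open>2 * k / t\<close> absorbs the passage from
    \<open>n\<close> to the epoch's end \<open>2 * n\<close>.\<close>
  also have "\<dots> \<le> 2 powr (3/4) * k powr (3/4) * t powr (1/4)"
    using t n0 k by (intro mult_mono powr_mono2 powr_mono mult_nonneg_nonneg powr_ge_zero) auto
  also have "\<dots> = t * (2 * k / t) powr (3/4)"
  proof -
    have t_eq: "t = t powr (3/4) * t powr (1/4)" using t0 by (simp flip: powr_add)
    have q: "(2 * k / t) powr (3/4) = 2 powr (3/4) * k powr (3/4) / t powr (3/4)"
      using k t0 by (simp add: powr_divide powr_mult)
    have "c * b = x * (c / a)" if "x = a * b" "a \<noteq> 0" for a b c x :: real
      using that by simp
    from this[OF t_eq] show ?thesis unfolding q using t0 by simp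
  qed
  finally have 2: "k powr (3/4) * (2 * n) powr (1/4) \<le> t * (2 * k / t) powr (3/4)" .
  have log0: "0 \<le> log 2 t" using t0 by simp
  have ln_l: "0 \<le> ln (l x)" if "0 \<le> x" for x using l_ge_1[OF that] by simp
  have 3: "n / 2 * ln (l (real (Suc j))) \<le> t * ln (l (log 2 t))"
  \<comment> \<open>Monotonicity is available from 1 onwards only. Below that, \<open>t < 2\<close>
    forces \<open>j = 0\<close>, and \<open>l\<close> is constant on \<open>[0, 1]\<close>.\<close>
  proof (cases "1 \<le> log 2 t")
    case True
    have "log 2 t \<le> log 2 (2 * n)" using t t0 by simp
    also have "\<dots> = real (Suc j)" using n by (simp add: log_mult)
    finally have "2 powr - real (Suc j) * ln (l (real (Suc j))) \<le> 2 powr - log 2 t * ln (l (log 2 t))"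
      using True by (intro monotone_onD[OF l_decr]) auto
    moreover have "2 powr - real (Suc j) = 1 / (2 * n)"
      using n by (simp only: powr_minus powr_realpow) (simp add: divide_simps)
    moreover have "2 powr - log 2 t = 1 / t" using t0 by (simp add: powr_minus divide_simps)
    ultimately have le: "ln (l (real (Suc j))) / (2 * n) \<le> ln (l (log 2 t)) / t" by simp
    have "n / 2 * ln (l (real (Suc j))) = n\<^sup>2 * (ln (l (real (Suc j))) / (2 * n))"
      using n0 by (simp add: power2_eq_square)
    also have "\<dots> \<le> t\<^sup>2 * (ln (l (log 2 t)) / t)"
      using le t n0 ln_l[of "real (Suc j)"] by (intro mult_mono power_mono) auto
    also have "\<dots> = t * ln (l (log 2 t))" using t0 by (simp add: power2_eq_square)
    finally show ?thesis .
  next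
    case False
    then have "t < 2" using t0 by (simp add: log_less_iff not_le)
    then have "n < 2" using t by simp
    then have "j = 0" using n power_increasing[of 1 j "2::real"] by (cases "j = 0") auto
    have "l (log 2 t) = l 1" using False log0 by (intro l_const) auto
    moreover have "n / 2 * ln (l 1) \<le> t * ln (l 1)"
      using t n0 ln_l[of 1] by (intro mult_right_mono) auto
    ultimately show ?thesis using \<open>j = 0\<close> by simp
  qed
  have \<delta>0: "0 \<le> ln (1 / \<delta>)" using \<delta> by simp
  then have "n / 2 * ln (1 / \<delta>) \<le> t * ln (1 / \<delta>)"
    using t n0 by (intro mult_right_mono) auto
  with 3 have "n / 2 * (ln (l (real (Suc j))) + ln (1 / \<delta>)) \<le> t * (ln (l (log 2 t)) + ln (1 / \<delta>))"
    by (simp only: distrib_left)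
  moreover have "0 \<le> n / 2 * (ln (l (real (Suc j))) + ln (1 / \<delta>))"
    using n0 \<delta>0 ln_l[of "real (Suc j)"] by (intro mult_nonneg_nonneg) auto
  \<comment> \<open>The target \<open>2 * t * sqrt (2 / t * ...)\<close> has square
    \<open>8 * t * ...\<close>. The previous inequality gives a factor 2, which nonnegativity allows
    to be enlarged to 8.\<close>
  ultimately have "n * (ln (l (real (Suc j))) + ln (1 / \<delta>)) \<le> 8 * (t * (ln (l (log 2 t)) + ln (1 / \<delta>)))"
    by linarith
  also have "\<dots> = 4 * (t\<^sup>2 * (2 / t * (ln (l (log 2 t)) + ln (1 / \<delta>))))"
    using t0 by (simp add: power2_eq_square)
  finally have "sqrt (n * (ln (l (real (Suc j))) + ln (1 / \<delta>)))
     \<le> 2 * (t * sqrt (2 / t * (ln (l (log 2 t)) + ln (1 / \<delta>))))"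
    unfolding mult_sqrt by (metis real_sqrt_four real_sqrt_le_mono real_sqrt_mult)
  with 1 2 show ?thesis
    by (simp only: distrib_left mult.left_commute[of t 2])
qed

section \<open>Union bound over the dyadic epochs\<close>

theorem corollary8:
  fixes M :: "'w measure" and P :: "'a measure" and A :: "'a set" and k :: nat
    and X :: "nat \<Rightarrow> 'w \<Rightarrow> 'a" and l :: "real \<Rightarrow> real" and \<delta> :: real
  assumes M: "prob_space M"
    and P: "prob_space P"
    and A: "finite A" "card A = k" "k \<ge> 2"
    and A_meas: "\<And>a. a \<in> A \<Longrightarrow> {a} \<in> sets P"
    and supp: "measure P A = 1"
    and indep: "prob_space.indep_vars M (\<lambda>_. P) X {1..}"
    and distr: "\<And>i. i \<ge> 1 \<Longrightarrow> distr M P (X i) = P"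
    and l_ge_1: "\<And>x. x \<ge> 0 \<Longrightarrow> l x \<ge> 1"
    and l_sum: "summable (\<lambda>j. 1 / l (real (Suc j)))" "(\<Sum>j. 1 / l (real (Suc j))) \<le> 1"
    and l_const: "\<And>x. 0 \<le> x \<Longrightarrow> x \<le> 1 \<Longrightarrow> l x = l 1"
    and l_decr: "antimono_on {1..} (\<lambda>u. 2 powr (- u) * ln (l u))"
    and \<delta>: "0 < \<delta>" "\<delta> < 1"
  shows "measure M {\<omega> \<in> space M. \<exists>t::nat. t \<ge> 1 \<and>
           tv_dist A (empirical_measure P X t \<omega>) P
             \<ge> sqrt (real k / (pi * real t))
               + 2 * (2 * real k / real t) powr (3 / 4)
               + 2 * sqrt (2 / real t * (ln (l (log 2 (real t))) + ln (1 / \<delta>)))} \<le> \<delta>"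
proof -
  define p where "p = (\<lambda>a. measure P {a})"
  interpret P: prob_space P by (rule P)
  interpret prob_space M by (rule M)
  have X_meas: "X i \<in> measurable M P" if "1 \<le> i" for i
    using indep that by (auto simp: indep_vars_def)
  have prob_X: "measure M (X i -` B \<inter> space M) = measure P B" if "1 \<le> i" "B \<in> sets P" for i B
    using measure_distr[OF X_meas[OF that(1)] that(2)] distr[OF that(1)] by simp
  have sum_p: "(\<Sum>a\<in>A. p a) = 1"
    using P.finite_measure_eq_sum_singleton[OF A(1) A_meas] supp by (simp add: p_def)
  interpret iid_sample A p M P X
    by standard (use A(1) A_meas sum_p indep prob_X in \<open>auto simp: p_def\<close>)

  define N where "N = (\<lambda>j::nat. 2 ^ Suc j :: nat)"
  define L where "L = (\<lambda>j. ln (l (real (Suc j))) + ln (1 / \<delta>))"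
  \<comment> \<open>The mean bound at time \<open>N j\<close> plus a deviation
    \<open>w = sqrt (2 ^ j * L j)\<close>, chosen so that
    \<open>2 * w\<^sup>2 / N j = L j\<close>.\<close>
  define v where "v = (\<lambda>j. sqrt (real k * (2 * 2 ^ j) / (2 * pi))
    + 2 * (real k powr (3/4) * (2 * 2 ^ j) powr (1/4)) + sqrt (2 ^ j * L j))"
  \<comment> \<open>With an empty prefix, any function can stand for the pinned samples. The event
    looks at all times up to \<open>N j\<close>, in particular at the epoch from
    \<open>2 ^ j\<close>.\<close>
  define H where "H = (\<lambda>j. hit_event (v j) 0 (N j) undefined)"

  \<comment> \<open>Strict positivity comes from \<open>\<delta> < 1\<close>, also where
    \<open>l\<close> equals 1; \<open>hit_prob_le\<close> asks for a positive deviation.\<close>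
  have L_pos: "0 < L j" for j
    using l_ge_1[of "real (Suc j)"] \<delta> by (auto simp: L_def intro!: add_nonneg_pos)
  have H_events: "H j \<in> events" for j
    unfolding H_def by (rule hit_event_sets) simp
  have H_le: "prob (H j) \<le> \<delta> * (1 / l (real (Suc j)))" for j
  proof -
    have "walk_exp A p (half_l1 A) (N j) (\<lambda>_. 0) + sqrt (2 ^ j * L j) \<le> v j"
      using walk_exp_half_l1_0_le[of "N j"] by (simp add: v_def N_def A(2))
    then have "hit_prob A p (v j) (N j) (\<lambda>_. 0) \<le> exp (- 2 * (sqrt (2 ^ j * L j))\<^sup>2 / real (N j))"
      using L_pos[of j] by (intro hit_prob_le) (auto simp: N_def)
    also have "- 2 * (sqrt (2 ^ j * L j))\<^sup>2 / real (N j) = - L j"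
      using L_pos[of j] by (simp add: N_def)
    also have "exp (- L j) = \<delta> * (1 / l (real (Suc j)))"
      using \<delta> l_ge_1[of "real (Suc j)"] by (simp add: L_def exp_minus exp_add exp_diff ln_div field_simps)
    finally show ?thesis
      using prob_hit_event_0_le[of "v j" "N j" undefined] by (simp add: H_def)
  qed

  have "AE \<omega> in M. X i \<omega> \<in> A" if "1 \<le> i" for i
  proof -
    have "prob (X i -` A \<inter> space M) = 1" using prob_X[OF that A_sets] supp by simp
    then have "AE \<omega> in M. \<omega> \<in> X i -` A \<inter> space M" by (rule AE_prob_1)
    then show ?thesis by eventually_elim simp
  qed
  then have AE_A: "AE \<omega> in M. \<forall>i\<in>{1..}. X i \<omega> \<in> A"
    by (subst AE_ball_countable) auto

  have cover: "\<omega> \<in> (\<Union>j. H j)"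
    if \<omega>: "\<omega> \<in> space M" "\<forall>i\<in>{1..}. X i \<omega> \<in> A" and t: "1 \<le> t"
      and dev: "tv_dist A (empirical_measure P X t \<omega>) P
             \<ge> sqrt (real k / (pi * real t))
               + 2 * (2 * real k / real t) powr (3 / 4)
               + 2 * sqrt (2 / real t * (ln (l (log 2 (real t))) + ln (1 / \<delta>)))" for \<omega> t
  proof -
    obtain j where j: "2 ^ j \<le> t" "t < 2 ^ (j + 1)"
      using ex_power_ivl1[of 2 t] t by auto
    have jr: "(2::real) ^ j \<le> real t" "real t \<le> 2 * 2 ^ j"
      using of_nat_mono[OF j(1), where 'a = real] of_nat_mono[OF less_imp_le[OF j(2)], where 'a = real]
      by simp_all
    have "v j \<le> real t * (sqrt (real k / (pi * real t))
               + 2 * (2 * real k / real t) powr (3 / 4)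
               + 2 * sqrt (2 / real t * (ln (l (log 2 (real t))) + ln (1 / \<delta>))))"
      unfolding v_def L_def
      by (rule epoch_threshold_le[OF refl jr _ l_ge_1 l_const l_decr \<delta>]) auto
    also have "\<dots> \<le> real t * tv_dist A (empirical_measure P X t \<omega>) P"
      using dev by (intro mult_left_mono) auto
    also have "\<dots> = half_l1 A (centred_counts p (\<lambda>i. X i \<omega>) t)"
      unfolding p_def by (rule tv_dist_empirical_measure[OF A_meas t])
    finally have "\<omega> \<in> H j"
      unfolding H_def hit_event_0 N_def using \<omega> j by (auto intro!: exI[of _ t])
    then show ?thesis by blast
  qed

  have sm: "summable (\<lambda>j. \<delta> * (1 / l (real (Suc j))))"
    using l_sum(1) by (rule summable_mult)
  have smH: "summable (\<lambda>j. prob (H j))"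
    by (rule summable_comparison_test'[OF sm, of 0]) (use H_le in auto)
  have "measure M {\<omega> \<in> space M. \<exists>t::nat. t \<ge> 1 \<and>
           tv_dist A (empirical_measure P X t \<omega>) P
             \<ge> sqrt (real k / (pi * real t))
               + 2 * (2 * real k / real t) powr (3 / 4)
               + 2 * sqrt (2 / real t * (ln (l (log 2 (real t))) + ln (1 / \<delta>)))} \<le> prob (\<Union>j. H j)"
  \<comment> \<open>The covering by the \<open>H j\<close> holds when every sample lies in
    \<open>A\<close>, hence outside a null set.\<close>
  proof (rule finite_measure_mono_AE)
    show "(\<Union>j. H j) \<in> events" using H_events by auto
    show "AE \<omega> in M. \<omega> \<in> {\<omega> \<in> space M. \<exists>t::nat. t \<ge> 1 \<and>
           tv_dist A (empirical_measure P X t \<omega>) P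
             \<ge> sqrt (real k / (pi * real t))
               + 2 * (2 * real k / real t) powr (3 / 4)
               + 2 * sqrt (2 / real t * (ln (l (log 2 (real t))) + ln (1 / \<delta>)))} \<longrightarrow> \<omega> \<in> (\<Union>j. H j)"
      using AE_A by eventually_elim (use cover in blast)
  qed
  also have "\<dots> \<le> (\<Sum>j. prob (H j))"
    using H_events smH by (intro finite_measure_subadditive_countably) auto
  also have "\<dots> \<le> (\<Sum>j. \<delta> * (1 / l (real (Suc j))))"
    by (rule suminf_le[OF H_le smH sm])
  also have "\<dots> = \<delta> * (\<Sum>j. 1 / l (real (Suc j)))"
    using l_sum(1) by (rule suminf_mult)
  also have "\<dots> \<le> \<delta> * 1"
    using l_sum(2) \<delta> by (intro mult_left_mono) auto
  finally show ?thesis by simp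
qed

end
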